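(* Let $l<h$ be such that $h/l$ is constant, and suppose that the private valuations take on only the two values $l$ and $h$. There does not exist a polynomial-time, monotone, constant-fraction welfare-preserving transformation (for downward-closed single-parameter environments), even when the transformation is allowed to be randomized and adaptive and make a polynomial number of queries to the feasibility set $\mathcal{F}$.
   Context: A single-parameter environment consists of $n$ agents, where agent $i$ has a private valuation $v_i\in\mathbb{R}$ (its value per unit of stuff that it gets; here $v_i\in\{l,h\}$), and a feasibility set $\mathcal{F}$ whose elements, the feasible allocations, are vectors $\mathbf{x}=(x_i)_{i=1}^n$ with $x_i\in\mathbb{R}$ denoting the amount of stuff given to agent $i$. The environment is downward-closed if, whenever we take an allocation in $\mathcal{F}$ and decrease the amount of stuff given to one of the agents, the resulting allocation is also in $\mathcal{F}$. Constant means not depending on $n$. An algorithm (or allocation rule) $\mathcal{A}$ is a function that takes a valuation vector $\mathbf{v}=(v_i)_{i=1}^n$ (the input) and outputs an allocation $\mathbf{x}\in\mathcal{F}$. The welfare of $\mathcal{A}$ at $\mathbf{v}$ is $\mathbf{v}\cdot\mathbf{x}=v_1x_1+\dots+v_nx_n$. An allocation rule is monotone if, whenever an agent increases its declared valuation while the declared valuations of the remaining agents stay fixed, the agent is allocated at least as much stuff as before. A transformation $\mathcal{T}$ is an algorithm that has black-box access to some other algorithm $\mathcal{A}$: in each query it specifies a valuation vector and obtains the allocation that $\mathcal{A}$ returns there. $\mathcal{T}(\mathcal{A})$ denotes $\mathcal{T}$ with access to $\mathcal{A}$. $\mathcal{T}$ has the knowledge that $\mathcal{F}$ is downward-closed.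 A query to $\mathcal{F}$ asks whether a particular allocation belongs to $\mathcal{F}$. $\mathcal{T}$ is adaptive if it can adjust its next query based on the responses it received for previous queries. Polynomial means polynomial in $n$. $\mathcal{T}$ is monotone if $\mathcal{T}(\mathcal{A})$ is a monotone allocation rule for any algorithm $\mathcal{A}$. $\mathcal{T}$ is constant-fraction welfare-preserving if, for any algorithm $\mathcal{A}$, $\mathcal{T}(\mathcal{A})$ preserves a constant fraction of the welfare of $\mathcal{A}$ at every input, i.e. for some constant $c>0$ its welfare at every input is at least $c$ times that of $\mathcal{A}$.
   Formalization: The value l is assumed positive: for l = 0 the ratio h/l is undefined, and for l < 0 the claim is false, since giving l-agents very negative amounts and each h-agent its amount in A(h,…,h) is monotone and preserves welfare. *)

theory Defs
  imports "HOL-Probability.Probability" "HOL-Computational_Algebra.Polynomial"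
begin

section \<open>Single-parameter environments with valuations in a two-element set\<close>

text \<open>
  Valuation vectors and allocations of an environment with agents \<open>0, \<dots>, n - 1\<close> are lists of
  length \<open>n\<close>.  Amounts of stuff are arbitrary reals, so downward-closedness puts no lower bound on
  the amount to which an agent may be decreased.
\<close>

definition valuations :: "real \<Rightarrow> real \<Rightarrow> nat \<Rightarrow> real list set" where
  "valuations l h n = {v. length v = n \<and> set v \<subseteq> {l, h}}"

definition downward_closed :: "nat \<Rightarrow> real list set \<Rightarrow> bool" where
  "downward_closed n F \<longleftrightarrow>
     (\<forall>x\<in>F. length x = n) \<and>
     (\<forall>x\<in>F. \<forall>i<n. \<forall>y. y \<le> x ! i \<longrightarrow> x[i := y] \<in> F)"

definition welfare :: "real list \<Rightarrow> real list \<Rightarrow> real" where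
  "welfare v x = (\<Sum>i<length v. v ! i * x ! i)"

text \<open>
  A problem instance: \<open>n\<close> agents, a downward-closed feasibility set \<open>F\<close> and an algorithm \<open>A\<close> for
  it.  The values of \<open>A\<close> outside the valuation vectors are irrelevant and left arbitrary.
\<close>

definition is_instance ::
  "real \<Rightarrow> real \<Rightarrow> nat \<Rightarrow> real list set \<Rightarrow> (real list \<Rightarrow> real list) \<Rightarrow> bool" where
  "is_instance l h n F A \<longleftrightarrow>
     n > 0 \<and> downward_closed n F \<and> (\<forall>v\<in>valuations l h n. A v \<in> F)"

text \<open>
  A (possibly randomized) allocation rule enters monotonicity through the expected amount \<open>X v i\<close>
  that agent \<open>i\<close> receives when the declared valuations are \<open>v\<close>.
\<close>

definition monotone_rule :: "real \<Rightarrow> real \<Rightarrow> nat \<Rightarrow> (real list \<Rightarrow> nat \<Rightarrow> real) \<Rightarrow> bool" where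
  "monotone_rule l h n X \<longleftrightarrow>
     (\<forall>v\<in>valuations l h n. \<forall>i<n. \<forall>w\<in>{l, h}. v ! i \<le> w \<longrightarrow> X v i \<le> X (v[i := w]) i)"


section \<open>Randomized adaptive oracle machines\<close>

text \<open>
  A transformation is a machine with states of type \<open>'s\<close>.  In one unit of time it outputs an
  allocation and stops, or makes an internal move, or flips a coin of a bias of its choice, or
  queries the algorithm at a vector, or asks whether a vector is feasible.  The next state may
  depend on the answer, so queries are adaptive.  The internal moves are not restricted to those of
  a particular machine model: a program in any concrete model in which coins and queries
  cost at least one step is such a machine, with its configurations as states.
\<close>

datatype 's action =
    Output "real list"
  | Internal 's
  | Flip real "bool \<Rightarrow> 's"
  | Query_Algorithm "real list" "real list \<Rightarrow> 's"
  | Query_Feasible "real list" "bool \<Rightarrow> 's"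

record 's transformation =
  initial :: "real list \<Rightarrow> 's"
  step :: "'s \<Rightarrow> 's action"

text \<open>
  The distribution of the result after at most \<open>t\<close> steps from state \<open>s\<close>; the value \<open>None\<close> means
  that the machine has not stopped yet.
\<close>

primrec run ::
  "'s transformation \<Rightarrow> (real list \<Rightarrow> real list) \<Rightarrow> real list set \<Rightarrow> nat \<Rightarrow> 's \<Rightarrow> real list option pmf"
where
  "run T A F 0 s = return_pmf None"
| "run T A F (Suc t) s =
     (case step T s of
        Output x \<Rightarrow> return_pmf (Some x)
      | Internal s' \<Rightarrow> run T A F t s'
      | Flip p k \<Rightarrow> bind_pmf (bernoulli_pmf p) (\<lambda>b. run T A F t (k b))
      | Query_Algorithm u k \<Rightarrow> run T A F t (k (A u))
      | Query_Feasible x k \<Rightarrow> run T A F t (k (x \<in> F)))"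

definition halts_within ::
  "'s transformation \<Rightarrow> (real list \<Rightarrow> real list) \<Rightarrow> real list set \<Rightarrow> real list \<Rightarrow> nat \<Rightarrow> bool" where
  "halts_within T A F v t \<longleftrightarrow> None \<notin> set_pmf (run T A F t (initial T v))"

text \<open>
  The random allocation returned by \<open>T\<close> with access to \<open>A\<close> and \<open>F\<close> at input \<open>v\<close>.  This is only
  meaningful if the machine stops within some time bound; it then has finite support, so that the
  expectations below exist.
\<close>

definition outcome ::
  "'s transformation \<Rightarrow> (real list \<Rightarrow> real list) \<Rightarrow> real list set \<Rightarrow> real list \<Rightarrow> real list pmf" where
  "outcome T A F v = map_pmf the (run T A F (LEAST t. halts_within T A F v t) (initial T v))"

definition expected_amount ::
  "'s transformation \<Rightarrow> (real list \<Rightarrow> real list) \<Rightarrow> real list set \<Rightarrow> real list \<Rightarrow> nat \<Rightarrow> real" where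
  "expected_amount T A F v i = measure_pmf.expectation (outcome T A F v) (\<lambda>x. x ! i)"

definition expected_welfare ::
  "'s transformation \<Rightarrow> (real list \<Rightarrow> real list) \<Rightarrow> real list set \<Rightarrow> real list \<Rightarrow> real" where
  "expected_welfare T A F v = measure_pmf.expectation (outcome T A F v) (welfare v)"


section \<open>Properties of transformations\<close>

definition polynomial_time :: "real \<Rightarrow> real \<Rightarrow> 's transformation \<Rightarrow> bool" where
  "polynomial_time l h T \<longleftrightarrow>
     (\<exists>p :: nat poly. \<forall>n F A. is_instance l h n F A \<longrightarrow>
        (\<forall>v\<in>valuations l h n. halts_within T A F v (poly p n)))"

definition outputs_feasible :: "real \<Rightarrow> real \<Rightarrow> 's transformation \<Rightarrow> bool" where
  "outputs_feasible l h T \<longleftrightarrow>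
     (\<forall>n F A. is_instance l h n F A \<longrightarrow>
        (\<forall>v\<in>valuations l h n. set_pmf (outcome T A F v) \<subseteq> F))"

definition monotone_transformation :: "real \<Rightarrow> real \<Rightarrow> 's transformation \<Rightarrow> bool" where
  "monotone_transformation l h T \<longleftrightarrow>
     (\<forall>n F A. is_instance l h n F A \<longrightarrow> monotone_rule l h n (expected_amount T A F))"

definition constant_fraction_welfare_preserving ::
  "real \<Rightarrow> real \<Rightarrow> 's transformation \<Rightarrow> bool" where
  "constant_fraction_welfare_preserving l h T \<longleftrightarrow>
     (\<exists>c>0. \<forall>n F A. is_instance l h n F A \<longrightarrow>
        (\<forall>v\<in>valuations l h n. expected_welfare T A F v \<ge> c * welfare v (A v)))"

end

theory Submission
  imports Defs "HOL-Real_Asymp.Real_Asymp"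
begin

text \<open>
  The lower bound exploits negative amounts.  The instance hides a set \<open>N\<close> of \<open>2a\<close> of the
  agents \<open>1, \<dots>, 4a\<close>.  The prize gives agent 0 an amount \<open>Z\<close> slightly above \<open>2a\<close> and charges
  every member of \<open>N\<close> one unit; the algorithm returns it if the agents with value \<open>h\<close> are exactly
  \<open>L\<close> members of \<open>N\<close>, and returns \<open>0\<close> otherwise.  Let \<open>p S\<close> be the probability that the
  transformation finds the prize when the agents in \<open>S \<subseteq> N\<close> have value \<open>h\<close>.

  If \<open>card S = L\<close>, preserving welfare forces \<open>p S \<ge> c / a\<close>.  If \<open>i \<in> N - S\<close>, then monotonicity
  charges agent \<open>i\<close> at \<open>S\<close> at least \<open>p (insert i S)\<close>.  As the expected welfare at \<open>S\<close> must not be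
  negative, charging all of \<open>N - S\<close> is only affordable by returning the prize, so \<open>p S\<close> is almost as
  large as the smallest \<open>p (insert i S)\<close>.  Hence \<open>p {} \<ge> c / (2a)\<close>: the prize is found although
  all values are \<open>l\<close>.  But a query reveals something about \<open>N\<close> with probability at most \<open>2\<^sup>-\<^sup>L\<close> only,
  because allocations charging \<open>3a\<close> agents are feasible regardless of \<open>N\<close>, and \<open>L\<close> may be of order
  \<open>sqrt a\<close>.
\<close>

section \<open>Runs on a family of instances\<close>

lemma prob_bind_bool:
  fixes M :: "bool pmf"
  shows "measure_pmf.prob (bind_pmf M f) X =
    (\<Sum>b\<in>UNIV. pmf M b * measure_pmf.prob (f b) X)"
proof -
  have "measure_pmf.prob (bind_pmf M f) X = measure_pmf.expectation M (\<lambda>b. measure_pmf.prob (f b) X)"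
    unfolding measure_pmf_bind
    using measurable_measure_pmf[of f]
    by (intro measure_pmf.measure_bind[where N="count_space UNIV"]) auto
  also have "\<dots> = (\<Sum>b\<in>UNIV. pmf M b *\<^sub>R measure_pmf.prob (f b) X)"
    by (rule integral_measure_pmf) auto
  finally show ?thesis by simp
qed

lemma finite_set_pmf_run: "finite (set_pmf (run T A F t s))"
  by (induction t arbitrary: s) (auto split: action.split)

text \<open>A machine that has stopped keeps its result, so a larger time budget can only move
  probability away from \<open>None\<close>.\<close>

lemma prob_run_Some_mono:
  assumes "t \<le> t'"
  shows "measure_pmf.prob (run T A F t s) (Some ` E) \<le> measure_pmf.prob (run T A F t' s) (Some ` E)"
  using assms
proof (induction t arbitrary: t' s)
  case 0
  then show ?case by (simp add: measure_return_pmf indicator_def image_iff)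
next
  case (Suc t)
  then obtain t'' where t': "t' = Suc t''" "t \<le> t''"
    by (cases t') auto
  show ?case
    unfolding t'(1)
    by (auto split: action.split simp: prob_bind_bool intro!: sum_mono mult_left_mono Suc.IH t'(2))
qed

text \<open>
  Union bound over the instances \<open>J\<close>: as long as a run has not asked about a point at which
  \<open>J\<close> differs from the reference instance \<open>A\<^sub>0, F\<^sub>0\<close>, it is the reference run.
\<close>

lemma sum_prob_run_le:
  fixes \<beta> :: real
  assumes "finite U" and "J \<subseteq> U" and "0 \<le> \<beta>"
    and alg: "\<And>u. real (card {j\<in>U. A j u \<noteq> A\<^sub>0 u}) \<le> \<beta>"
    and feas: "\<And>x. real (card {j\<in>U. (x \<in> F j) \<noteq> (x \<in> F\<^sub>0)}) \<le> \<beta>"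
  shows "(\<Sum>j\<in>J. measure_pmf.prob (run T (A j) (F j) t s) (Some ` (F j - F\<^sub>0))) \<le> real t * \<beta>"
  using \<open>J \<subseteq> U\<close>
proof (induction t arbitrary: s J)
  case 0
  then show ?case by (simp add: measure_return_pmf indicator_def image_iff)
next
  case (Suc t)
  have fin: "finite J" using Suc.prems assms(1) finite_subset by blast
  let ?p = "\<lambda>t s j. measure_pmf.prob (run T (A j) (F j) t s) (Some ` (F j - F\<^sub>0))"
  have mono: "real t * \<beta> \<le> real (Suc t) * \<beta>"
    using assms(3) by (simp add: algebra_simps)
  \<comment> \<open>Serves both kinds of query: \<open>k j\<close> is the state reached in instance
    \<open>j\<close>, and \<open>s'\<close> the one reached in the reference instance. Deviating
    instances are charged probability 1 and dropped from \<open>J\<close>; hence the induction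
    ranges over all \<open>J \<subseteq> U\<close>, while \<open>\<beta>\<close> refers to the fixed
    \<open>U\<close>.\<close>
  have query: "(\<Sum>j\<in>J. ?p t (k j) j) \<le> real (Suc t) * \<beta>"
    if bad: "real (card {j\<in>U. k j \<noteq> s'}) \<le> \<beta>" for k s'
  proof -
    let ?B = "{j\<in>J. k j \<noteq> s'}"
    have "(\<Sum>j\<in>J. ?p t (k j) j) = (\<Sum>j\<in>J - ?B. ?p t (k j) j) + (\<Sum>j\<in>?B. ?p t (k j) j)"
      by (rule sum.subset_diff) (use fin in auto)
    also have "(\<Sum>j\<in>J - ?B. ?p t (k j) j) = (\<Sum>j\<in>J - ?B. ?p t s' j)"
      by (rule sum.cong) auto
    also have "\<dots> \<le> real t * \<beta>"
      by (rule Suc.IH) (use Suc.prems in auto)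
    also have "(\<Sum>j\<in>?B. ?p t (k j) j) \<le> (\<Sum>j\<in>?B. 1)"
      by (rule sum_mono) auto
    also have "\<dots> \<le> real (card {j\<in>U. k j \<noteq> s'})"
      using assms(1) Suc.prems by (auto intro!: card_mono)
    also have "\<dots> \<le> \<beta>" by (rule bad)
    finally show ?thesis by (simp add: algebra_simps)
  qed
  show ?case
  proof (cases "step T s")
    \<comment> \<open>A machine may also guess without asking; a fixed output is a hit in at most
      \<open>\<beta>\<close> instances, which this last step pays for.\<close>
    case (Output x)
    have "(\<Sum>j\<in>J. ?p (Suc t) s j) = (\<Sum>j\<in>J. if x \<in> F j - F\<^sub>0 then 1 else 0)"
      by (rule sum.cong) (auto simp: Output measure_return_pmf indicator_def)
    also have "\<dots> = real (card {j\<in>J. x \<in> F j - F\<^sub>0})"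
      using fin by (simp add: sum.If_cases Int_def)
    also have "\<dots> \<le> real (card {j\<in>U. (x \<in> F j) \<noteq> (x \<in> F\<^sub>0)})"
      using assms(1) Suc.prems by (auto intro!: card_mono)
    also have "\<dots> \<le> \<beta>" by (rule feas)
    also have "\<dots> \<le> real (Suc t) * \<beta>"
      using assms(3) by (simp add: algebra_simps)
    finally show ?thesis .
  next
    case (Internal s')
    have "(\<Sum>j\<in>J. ?p (Suc t) s j) \<le> real t * \<beta>"
      using Suc.IH[OF Suc.prems, of s'] by (simp add: Internal)
    with mono show ?thesis by linarith
  next
    case (Flip p k)
    let ?M = "bernoulli_pmf p"
    have "(\<Sum>j\<in>J. ?p (Suc t) s j) = (\<Sum>j\<in>J. \<Sum>b\<in>UNIV. pmf ?M b * ?p t (k b) j)"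
      by (simp only: run.simps Flip action.case prob_bind_bool)
    also have "\<dots> = (\<Sum>b\<in>UNIV. pmf ?M b * (\<Sum>j\<in>J. ?p t (k b) j))"
      by (subst sum.swap) (simp only: sum_distrib_left)
    also have "\<dots> \<le> (\<Sum>b\<in>UNIV. pmf ?M b * (real t * \<beta>))"
      by (intro sum_mono mult_left_mono Suc.IH Suc.prems) auto
    also have "\<dots> = real t * \<beta>"
      by (simp only: sum_distrib_right[symmetric] sum_pmf_eq_1[OF finite subset_UNIV] mult_1)
    finally show ?thesis using mono by linarith
  next
    case (Query_Algorithm u k)
    have "real (card {j\<in>U. k (A j u) \<noteq> k (A\<^sub>0 u)}) \<le> real (card {j\<in>U. A j u \<noteq> A\<^sub>0 u})"
      using assms(1) by (auto intro!: card_mono)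
    then have "(\<Sum>j\<in>J. ?p t (k (A j u)) j) \<le> real (Suc t) * \<beta>"
      using alg[of u] by (intro query[of _ "k (A\<^sub>0 u)"]) linarith
    then show ?thesis by (simp add: Query_Algorithm)
  next
    case (Query_Feasible x k)
    have "real (card {j\<in>U. k (x \<in> F j) \<noteq> k (x \<in> F\<^sub>0)})
        \<le> real (card {j\<in>U. (x \<in> F j) \<noteq> (x \<in> F\<^sub>0)})"
    proof (intro of_nat_mono card_mono)
      show "{j\<in>U. k (x \<in> F j) \<noteq> k (x \<in> F\<^sub>0)} \<subseteq> {j\<in>U. (x \<in> F j) \<noteq> (x \<in> F\<^sub>0)}"
      proof
        fix j
        assume j: "j \<in> {j\<in>U. k (x \<in> F j) \<noteq> k (x \<in> F\<^sub>0)}"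
        then have "(x \<in> F j) \<noteq> (x \<in> F\<^sub>0)" by (intro notI) simp
        with j show "j \<in> {j\<in>U. (x \<in> F j) \<noteq> (x \<in> F\<^sub>0)}" by blast
      qed
    qed (use assms(1) in simp)
    then have "(\<Sum>j\<in>J. ?p t (k (x \<in> F j)) j) \<le> real (Suc t) * \<beta>"
      using feas[of x] by (intro query[of _ "k (x \<in> F\<^sub>0)"]) linarith
    then show ?thesis by (simp add: Query_Feasible)
  qed
qed

text \<open>\<open>outcome\<close> stops at the least halting time, which may differ between
  instances; the union bound needs one budget \<open>t\<close> for all of them.\<close>

lemma prob_outcome_le_run:
  assumes "halts_within T A F v t"
  shows "measure_pmf.prob (outcome T A F v) E \<le> measure_pmf.prob (run T A F t (initial T v)) (Some ` E)"
proof -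
  define t\<^sub>0 where "t\<^sub>0 = (LEAST t. halts_within T A F v t)"
  have halts: "halts_within T A F v t\<^sub>0" and "t\<^sub>0 \<le> t"
    unfolding t\<^sub>0_def using assms by (auto intro: LeastI Least_le)
  have "measure_pmf.prob (outcome T A F v) E
      = measure_pmf.prob (run T A F t\<^sub>0 (initial T v)) (the -` E)"
    by (simp add: outcome_def t\<^sub>0_def)
  also have "\<dots> = measure_pmf.prob (run T A F t\<^sub>0 (initial T v))
      (the -` E \<inter> set_pmf (run T A F t\<^sub>0 (initial T v)))"
    by (simp add: measure_Int_set_pmf)
  also have "\<dots> \<le> measure_pmf.prob (run T A F t\<^sub>0 (initial T v)) (Some ` E)"
  proof (rule measure_pmf.finite_measure_mono)
    show "the -` E \<inter> set_pmf (run T A F t\<^sub>0 (initial T v)) \<subseteq> Some ` E"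
    proof
      fix y
      assume y: "y \<in> the -` E \<inter> set_pmf (run T A F t\<^sub>0 (initial T v))"
      \<comment> \<open>The arbitrary value \<open>the None\<close> might belong to
        \<open>E\<close>; halting excludes this case.\<close>
      then have "y \<noteq> None" using halts by (metis IntD2 halts_within_def)
      then show "y \<in> Some ` E" using y by (cases y) auto
    qed
  qed simp
  also have "\<dots> \<le> measure_pmf.prob (run T A F t (initial T v)) (Some ` E)"
    by (rule prob_run_Some_mono[OF \<open>t\<^sub>0 \<le> t\<close>])
  finally show ?thesis .
qed

lemma finite_set_pmf_outcome: "finite (set_pmf (outcome T A F v))"
  by (simp add: outcome_def finite_set_pmf_run)

section \<open>Instances with a secret set of paying agents\<close>

text \<open>
  Agents \<open>1, \<dots>, 4a\<close> can only pay (receive nonpositive amounts).  A feasible allocation with a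
  positive amount for agent 0 makes either \<open>3a\<close> agents or all members of the secret set \<open>N\<close> pay.
\<close>

definition decoys :: "real \<Rightarrow> nat \<Rightarrow> real list set" where
  "decoys Z a = {x. length x = Suc (4 * a) \<and> (\<forall>i\<in>{1..4 * a}. x ! i \<le> 0) \<and>
     (x ! 0 \<le> 0 \<or> x ! 0 \<le> Z \<and> 3 * a \<le> card {i\<in>{1..4 * a}. x ! i \<le> -1})}"

definition hidden :: "real \<Rightarrow> nat \<Rightarrow> nat set \<Rightarrow> real list set" where
  "hidden Z a N = {x. length x = Suc (4 * a) \<and> (\<forall>i\<in>{1..4 * a}. x ! i \<le> 0) \<and>
     x ! 0 \<le> Z \<and> (\<forall>i\<in>N. x ! i \<le> -1)}"

text \<open>The pointwise largest element of \<open>hidden Z a N\<close> if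
  \<open>N \<subseteq> {1..4 * a}\<close>.\<close>

definition prize :: "real \<Rightarrow> nat \<Rightarrow> nat set \<Rightarrow> real list" where
  "prize Z a N = map (\<lambda>i. if i = 0 then Z else if i \<in> N then -1 else 0) [0..<Suc (4 * a)]"

definition high_agents :: "real \<Rightarrow> real list \<Rightarrow> nat set" where
  "high_agents h v = {i. i < length v \<and> v ! i = h}"

definition algorithm :: "real \<Rightarrow> real \<Rightarrow> nat \<Rightarrow> nat \<Rightarrow> nat set \<Rightarrow> real list \<Rightarrow> real list" where
  "algorithm h Z a L N v =
     (if high_agents h v \<subseteq> N \<and> card (high_agents h v) = L then prize Z a N
      else replicate (Suc (4 * a)) 0)"

lemma decoys_antimono:
  assumes "x \<in> decoys Z a" "length y = length x" "\<And>i. i < length x \<Longrightarrow> y ! i \<le> x ! i"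
  shows "y \<in> decoys Z a"
proof -
  have len: "length x = Suc (4 * a)" using assms(1) by (simp add: decoys_def)
  have le: "y ! i \<le> x ! i" if "i \<le> 4 * a" for i
    using assms(3) len that by simp
  have "card {i\<in>{1..4 * a}. x ! i \<le> -1} \<le> card {i\<in>{1..4 * a}. y ! i \<le> -1}"
    by (intro card_mono) (auto intro: order_trans[OF le])
  then show ?thesis
    using assms(1,2) le[of 0] order_trans[OF le]
    by (auto simp: decoys_def)
qed

lemma hidden_antimono:
  assumes "x \<in> hidden Z a N" "N \<subseteq> {1..4 * a}" "length y = length x"
    and "\<And>i. i < length x \<Longrightarrow> y ! i \<le> x ! i"
  shows "y \<in> hidden Z a N"
proof -
  have len: "length x = Suc (4 * a)" using assms(1) by (simp add: hidden_def)
  have le: "y ! i \<le> x ! i" if "i \<le> 4 * a" for i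
    using assms(4) len that by simp
  have "y ! i \<le> -1" if "i \<in> N" for i
    using assms(1,2) that le[of i] by (force simp: hidden_def)
  then show ?thesis
    using assms(1,3) le[of 0] order_trans[OF le]
    by (auto simp: hidden_def)
qed

lemma sum_le_minus_card:
  fixes f :: "'a \<Rightarrow> real"
  assumes "finite B" "M \<subseteq> B" "\<And>i. i \<in> B \<Longrightarrow> f i \<le> 0" "\<And>i. i \<in> M \<Longrightarrow> f i \<le> -1"
  shows "sum f B \<le> - real (card M)"
proof -
  have "sum f B \<le> (\<Sum>i\<in>B. if i \<in> M then -1 else 0)"
    using assms by (intro sum_mono) auto
  also have "\<dots> = (\<Sum>i\<in>M. -1)"
    using assms(1,2) by (simp add: sum.If_cases Int_absorb1)
  finally show ?thesis by simp
qed

text \<open>By \<open>margin\<close>, the prize is still worth at least \<open>l\<close> when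
  \<open>L\<close> members of \<open>N\<close> have value \<open>h\<close>. By
  \<open>a_large\<close>, losing a factor \<open>1 - \<sigma> / a\<close> in each of
  \<open>L\<close> steps costs at most one half.\<close>

locale hidden_instance =
  fixes l h \<sigma> :: real and a L :: nat and N :: "nat set"
  assumes l_pos: "0 < l" and l_less_h: "l < h"
    and N_sub: "N \<subseteq> {1..4 * a}" and card_N: "card N = 2 * a"
    and L_pos: "0 < L" and margin: "l + (h - l) * real L \<le> l * \<sigma>"
    and a_large: "2 * real L * \<sigma> \<le> real a"
begin

definition Z :: real where "Z = 2 * real a + \<sigma>"

definition F :: "real list set" where "F = decoys Z a \<union> hidden Z a N"

abbreviation A :: "real list \<Rightarrow> real list" where "A \<equiv> algorithm h Z a L N"

definition val :: "nat set \<Rightarrow> real list" where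
  "val S = map (\<lambda>i. if i \<in> S then h else l) [0..<Suc (4 * a)]"

text \<open>For \<open>S \<subseteq> N\<close> this is the welfare of the prize at
  \<open>val S\<close>, see \<open>welfare_prize\<close>.\<close>

definition W :: "nat set \<Rightarrow> real" where "W S = l * \<sigma> - (h - l) * real (card S)"

text \<open>Equals \<open>l * (3 * a - Z)\<close>: the welfare lost by a decoy that grants
  \<open>Z\<close> and charges one unit to each of \<open>3 * a\<close> agents, all values being
  \<open>l\<close>.\<close>

definition \<kappa> :: real where "\<kappa> = l * (real a - \<sigma>)"

lemma \<sigma>_ge_1: "1 \<le> \<sigma>"
proof -
  have "l * 1 \<le> l + (h - l) * real L" using l_less_h by simp
  also have "\<dots> \<le> l * \<sigma>" by (rule margin)
  finally show ?thesis using l_pos mult_le_cancel_left_pos by blast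
qed

lemma twice_\<sigma>_le: "2 * \<sigma> \<le> real a"
proof -
  have "2 * 1 * \<sigma> \<le> 2 * real L * \<sigma>"
    using L_pos \<sigma>_ge_1 by (intro mult_right_mono mult_left_mono) auto
  with a_large show ?thesis by simp
qed

lemma L_le_a: "L \<le> a"
proof -
  have "2 * real L * 1 \<le> 2 * real L * \<sigma>" using \<sigma>_ge_1 by (intro mult_left_mono) auto
  with a_large show ?thesis by simp
qed

lemma finite_N: "finite N"
  using N_sub finite_subset by blast

lemma \<kappa>_pos: "0 < \<kappa>"
  using l_pos twice_\<sigma>_le \<sigma>_ge_1 by (simp add: \<kappa>_def)

lemma length_val [simp]: "length (val S) = Suc (4 * a)"
  by (simp add: val_def)

lemma nth_val: "i < Suc (4 * a) \<Longrightarrow> val S ! i = (if i \<in> S then h else l)"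
  by (simp add: val_def del: upt_Suc)

lemma val_in_valuations: "val S \<in> valuations l h (Suc (4 * a))"
  by (auto simp: valuations_def val_def)

lemma high_agents_val: "S \<subseteq> N \<Longrightarrow> high_agents h (val S) = S"
  using l_less_h N_sub by (auto simp: high_agents_def nth_val subset_iff split: if_splits)

lemma nth_prize: "i < Suc (4 * a) \<Longrightarrow>
    prize Z a N ! i = (if i = 0 then Z else if i \<in> N then -1 else 0)"
  by (simp add: prize_def del: upt_Suc)

lemma is_instance: "is_instance l h (Suc (4 * a)) F A"
  unfolding is_instance_def
proof (intro conjI ballI)
  show "downward_closed (Suc (4 * a)) F"
    unfolding downward_closed_def
  proof (intro conjI ballI allI impI)
    fix x i and y :: real
    assume x: "x \<in> F" and "i < Suc (4 * a)" and y: "y \<le> x ! i"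
    have "x[i := y] ! j \<le> x ! j" if "j < length x" for j
      using y that by (cases "j = i") auto
    then show "x[i := y] \<in> F"
      using x decoys_antimono[of x Z a "x[i := y]"] hidden_antimono[OF _ N_sub, of x Z "x[i := y]"]
      by (auto simp: F_def)
  qed (auto simp: F_def decoys_def hidden_def)
  fix v
  have "prize Z a N \<in> hidden Z a N"
    using N_sub by (auto simp: hidden_def nth_prize subset_iff)
      (auto simp: prize_def)
  moreover have "replicate (Suc (4 * a)) 0 \<in> decoys Z a"
    by (auto simp: decoys_def nth_Cons split: nat.split)
  ultimately show "A v \<in> F"
    by (simp add: algorithm_def F_def)
qed simp

section \<open>Welfare of feasible allocations\<close>

lemma welfare_val:
  assumes "S \<subseteq> N"
  shows "welfare (val S) x =
    l * x ! 0 + h * (\<Sum>i\<in>S. x ! i) + l * (\<Sum>i\<in>N - S. x ! i) + l * (\<Sum>i\<in>{1..4 * a} - N. x ! i)"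
proof -
  have "{..<Suc (4 * a)} = insert 0 {1..4 * a}" by auto
  then have "welfare (val S) x = val S ! 0 * x ! 0 + (\<Sum>i\<in>{1..4 * a}. val S ! i * x ! i)"
    by (simp add: welfare_def del: sum.lessThan_Suc)
  also have "val S ! 0 = l" using assms N_sub by (auto simp: nth_val)
  also have "(\<Sum>i\<in>{1..4 * a}. val S ! i * x ! i)
      = (\<Sum>i\<in>{1..4 * a} - N. val S ! i * x ! i) + (\<Sum>i\<in>N. val S ! i * x ! i)"
    by (rule sum.subset_diff[OF N_sub]) simp
  also have "(\<Sum>i\<in>N. val S ! i * x ! i)
      = (\<Sum>i\<in>N - S. val S ! i * x ! i) + (\<Sum>i\<in>S. val S ! i * x ! i)"
    by (rule sum.subset_diff[OF assms finite_N])
  also have "(\<Sum>i\<in>S. val S ! i * x ! i) = h * (\<Sum>i\<in>S. x ! i)"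
    unfolding sum_distrib_left by (rule sum.cong) (use assms N_sub in \<open>auto simp: nth_val subset_iff\<close>)
  also have "(\<Sum>i\<in>N - S. val S ! i * x ! i) = l * (\<Sum>i\<in>N - S. x ! i)"
    unfolding sum_distrib_left by (rule sum.cong) (use N_sub in \<open>auto simp: nth_val subset_iff\<close>)
  also have "(\<Sum>i\<in>{1..4 * a} - N. val S ! i * x ! i) = l * (\<Sum>i\<in>{1..4 * a} - N. x ! i)"
    unfolding sum_distrib_left by (rule sum.cong) (use assms in \<open>auto simp: nth_val\<close>)
  finally show ?thesis by simp
qed

lemma card_diff_real:
  assumes "S \<subseteq> N"
  shows "real (card (N - S)) = 2 * real a - real (card S)"
proof -
  have "finite S" using assms finite_N finite_subset by blast
  moreover have "card S \<le> card N" using assms finite_N by (rule card_mono[rotated])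
  ultimately show ?thesis
    using card_Diff_subset[OF _ assms] card_N by simp
qed

lemma welfare_prize:
  assumes "S \<subseteq> N"
  shows "welfare (val S) (prize Z a N) = W S"
proof -
  have "(\<Sum>i\<in>S. prize Z a N ! i) = (\<Sum>i\<in>S. -1)"
    by (rule sum.cong) (use assms N_sub in \<open>auto simp: nth_prize subset_iff\<close>)
  moreover have "(\<Sum>i\<in>N - S. prize Z a N ! i) = (\<Sum>i\<in>N - S. -1)"
    by (rule sum.cong) (use N_sub in \<open>auto simp: nth_prize subset_iff\<close>)
  moreover have "(\<Sum>i\<in>{1..4 * a} - N. prize Z a N ! i) = 0"
    by (rule sum.neutral) (auto simp: nth_prize)
  moreover have "prize Z a N ! 0 = Z" by (simp add: nth_prize)
  ultimately have "welfare (val S) (prize Z a N)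
      = l * Z - h * real (card S) - l * real (card (N - S))"
    by (simp add: welfare_val[OF assms])
  then show ?thesis
    unfolding card_diff_real[OF assms] W_def Z_def by (simp add: algebra_simps)
qed

text \<open>
  Lowering the amounts of the agents in \<open>N - S\<close> costs welfare, and only the allocations that
  reveal \<open>N\<close> can make up for it.
\<close>

lemma welfare_le:
  assumes S: "S \<subseteq> N" "card S \<le> L" and x: "x \<in> F"
  shows "welfare (val S) x \<le> (W S + \<kappa>) * indicator (F - decoys Z a) x
    + \<kappa> / real (card (N - S)) * (\<Sum>i\<in>N - S. x ! i)"
proof -
  define r where "r = real (card (N - S))"
  \<comment> \<open>The weight for combining \<open>X1\<close> and \<open>X2\<close> below:
    \<open>\<theta> * r = real a - \<sigma>\<close> turns
    \<open>- 3 * real a + \<theta> * (Y + r)\<close> into \<open>\<theta> * Y - Z\<close>.\<close>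
  define \<theta> where "\<theta> = (real a - \<sigma>) / r"
  define Y where "Y = (\<Sum>i\<in>N - S. x ! i)"
  define X where "X = (\<Sum>i\<in>{1..4 * a}. x ! i)"
  have r: "r = 2 * real a - real (card S)" unfolding r_def by (rule card_diff_real[OF S(1)])
  have r_ge: "real a \<le> r" using S(2) L_le_a r by linarith
  have r_pos: "0 < r" using r_ge twice_\<sigma>_le \<sigma>_ge_1 by linarith
  have \<theta>: "0 \<le> \<theta>" "\<theta> \<le> 1" "\<theta> * r = real a - \<sigma>"
    using r_ge r_pos twice_\<sigma>_le \<sigma>_ge_1 by (auto simp: \<theta>_def divide_simps)
  have \<kappa>r: "\<kappa> / r = l * \<theta>" by (simp add: \<kappa>_def \<theta>_def)
  have x_le: "x ! i \<le> 0" if "i \<in> {1..4 * a}" for i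
    using x that by (auto simp: F_def decoys_def hidden_def)
  have S_sub: "S \<subseteq> {1..4 * a}" and NS_sub: "N - S \<subseteq> {1..4 * a}" using S N_sub by auto
  have fin_S: "finite S" using S(1) finite_N finite_subset by blast
  have sum_nonpos: "(\<Sum>i\<in>B. x ! i) \<le> 0" if "B \<subseteq> {1..4 * a}" for B
    using that x_le by (intro sum_nonpos) auto
  have X_split: "X = (\<Sum>i\<in>S. x ! i) + Y + (\<Sum>i\<in>{1..4 * a} - N. x ! i)"
    unfolding X_def Y_def
    using sum.subset_diff[OF N_sub, of "\<lambda>i. x ! i"] sum.subset_diff[OF S(1) finite_N, of "\<lambda>i. x ! i"]
    by simp
  have welfare: "welfare (val S) x
      = l * x ! 0 + h * (\<Sum>i\<in>S. x ! i) + l * Y + l * (\<Sum>i\<in>{1..4 * a} - N. x ! i)"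
    unfolding Y_def by (rule welfare_val[OF S(1)])
  have "h * (\<Sum>i\<in>S. x ! i) \<le> l * (\<Sum>i\<in>S. x ! i)"
    using sum_nonpos[OF S_sub] l_less_h by (intro mult_right_mono_neg) auto
  then have welfare_le_X: "welfare (val S) x \<le> l * (x ! 0 + X)"
    unfolding welfare X_split by (simp add: algebra_simps)
  have Y_nonpos: "Y \<le> 0" unfolding Y_def by (rule sum_nonpos[OF NS_sub])
  have "welfare (val S) x \<le> (W S + \<kappa>) * indicator (F - decoys Z a) x + \<kappa> / r * Y"
  proof (cases "x \<in> decoys Z a")
    case True
    have "x ! 0 + X \<le> \<theta> * Y"
    proof (cases "x ! 0 \<le> 0")
      case True
      have "X \<le> Y"
        unfolding X_split using sum_nonpos[OF S_sub] sum_nonpos[of "{1..4 * a} - N"] by auto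
      also have "1 * Y \<le> \<theta> * Y" using \<theta> Y_nonpos by (intro mult_right_mono_neg)
      finally show ?thesis using True by simp
    next
      case False
      define M where "M = {i\<in>{1..4 * a}. x ! i \<le> -1}"
      have x0: "x ! 0 \<le> Z" and M: "3 * a \<le> card M"
        using \<open>x \<in> decoys Z a\<close> False by (auto simp: decoys_def M_def)
      have "X \<le> - real (card M)"
        unfolding X_def by (rule sum_le_minus_card) (use x_le in \<open>auto simp: M_def\<close>)
      then have X1: "X \<le> - 3 * real a" using M by linarith
      \<comment> \<open>At most \<open>r\<close> of the charged agents lie in \<open>N - S\<close>,
        so at least \<open>3 * a - r\<close> further units are paid on top of
        \<open>Y\<close>.\<close>
      have "(\<Sum>i\<in>{1..4 * a} - (N - S). x ! i) \<le> - real (card (M - (N - S)))"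
        by (rule sum_le_minus_card) (use x_le in \<open>auto simp: M_def\<close>)
      moreover have "card M \<le> card (M - (N - S)) + card (N - S)"
        by (rule order_trans[OF card_mono card_Un_le])
          (use finite_N in \<open>auto simp: M_def\<close>)
      moreover have "X = (\<Sum>i\<in>{1..4 * a} - (N - S). x ! i) + Y"
        unfolding X_def Y_def by (rule sum.subset_diff[OF NS_sub]) simp
      ultimately have X2: "X \<le> Y - 3 * real a + r"
        using M unfolding r_def by linarith
      have "X = (1 - \<theta>) * X + \<theta> * X" by (simp add: algebra_simps)
      also have "\<dots> \<le> (1 - \<theta>) * (- 3 * real a) + \<theta> * (Y - 3 * real a + r)"
        using X1 X2 \<theta> by (intro add_mono mult_left_mono) auto
      also have "\<dots> = \<theta> * Y - Z"
        using \<theta>(3) unfolding Z_def by (simp add: algebra_simps)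
      finally show ?thesis using x0 by simp
    qed
    then have "l * (x ! 0 + X) \<le> l * (\<theta> * Y)" using l_pos by (intro mult_left_mono) auto
    then show ?thesis
      using True welfare_le_X unfolding \<kappa>r by (simp add: mult.assoc)
  next
    case False
    then have "x \<in> hidden Z a N" using x by (simp add: F_def)
    then have x0: "x ! 0 \<le> Z" and x_N: "\<And>i. i \<in> N \<Longrightarrow> x ! i \<le> -1"
      by (auto simp: hidden_def)
    have "(\<Sum>i\<in>S. x ! i) \<le> - real (card S)"
      by (rule sum_le_minus_card) (use S fin_S x_N in force)+
    then have "h * (\<Sum>i\<in>S. x ! i) \<le> h * (- real (card S))"
      using l_pos l_less_h by (intro mult_left_mono) auto
    moreover have "l * x ! 0 \<le> l * Z" using x0 l_pos by simp
    moreover have "l * (\<Sum>i\<in>{1..4 * a} - N. x ! i) \<le> 0"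
      using sum_nonpos[of "{1..4 * a} - N"] l_pos by (intro mult_nonneg_nonpos) auto
    ultimately have "welfare (val S) x \<le> l * Z - h * real (card S) + l * Y"
      unfolding welfare by linarith
    also have "\<dots> = W S + l * (r + Y)"
      unfolding Z_def W_def r by (simp add: algebra_simps)
    \<comment> \<open>Everyone in \<open>N - S\<close> pays at least one unit, so
      \<open>r + Y\<close> is nonpositive and scaling it by \<open>\<theta>\<close> increases it.
      This brings the slope in \<open>Y\<close> to the rate that holds for decoys.\<close>
    also have "l * (r + Y) \<le> l * (\<theta> * (r + Y))"
    proof -
      have "Y \<le> - r" unfolding Y_def r_def
        by (rule sum_le_minus_card) (use finite_N x_N in force)+
      then have "1 * (r + Y) \<le> \<theta> * (r + Y)" using \<theta> by (intro mult_right_mono_neg) auto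
      then show ?thesis using l_pos by simp
    qed
    also have "l * (\<theta> * (r + Y)) = \<kappa> + \<kappa> / r * Y"
      unfolding \<kappa>r unfolding \<kappa>_def \<theta>(3)[symmetric] by (simp only: distrib_left mult.assoc)
    finally show ?thesis using False x by simp
  qed
  then show ?thesis by (simp add: Y_def r_def)
qed

end

section \<open>The probability of finding the prize\<close>

locale hidden_instance_transformation = hidden_instance +
  fixes T :: "'s transformation" and c :: real
  assumes c_pos: "0 < c"
    and feasible: "\<And>v. v \<in> valuations l h (Suc (4 * a)) \<Longrightarrow> set_pmf (outcome T A F v) \<subseteq> F"
    and monotone: "monotone_rule l h (Suc (4 * a)) (expected_amount T A F)"
    and preserving: "\<And>v. v \<in> valuations l h (Suc (4 * a)) \<Longrightarrow>
      c * welfare v (A v) \<le> expected_welfare T A F v"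
begin

text \<open>Any output that is feasible only because of \<open>N\<close> counts as finding the
  prize, lowered versions of it included.\<close>

definition p :: "nat set \<Rightarrow> real" where
  "p S = measure_pmf.prob (outcome T A F (val S)) (F - decoys Z a)"

abbreviation amount :: "nat set \<Rightarrow> nat \<Rightarrow> real" where
  "amount S \<equiv> expected_amount T A F (val S)"

lemma p_nonneg: "0 \<le> p S"
  by (simp add: p_def)

lemma integrable_outcome:
  fixes f :: "real list \<Rightarrow> real"
  shows "integrable (measure_pmf (outcome T A F v)) f"
  by (rule integrable_measure_pmf_finite[OF finite_set_pmf_outcome])

lemma expectation_mono:
  fixes f g :: "real list \<Rightarrow> real"
  assumes "\<And>x. x \<in> F \<Longrightarrow> f x \<le> g x"
  shows "measure_pmf.expectation (outcome T A F (val S)) f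
    \<le> measure_pmf.expectation (outcome T A F (val S)) g"
  using assms feasible[OF val_in_valuations]
  by (intro integral_mono_AE integrable_outcome) (auto simp: AE_measure_pmf_iff)

text \<open>Outputs in \<open>F - decoys Z a\<close> lie in \<open>hidden Z a N\<close> and charge
  each member of \<open>N\<close> at least one unit; no feasible output gives it a positive
  amount.\<close>

lemma amount_le: "i \<in> N \<Longrightarrow> amount S i \<le> - p S"
proof -
  assume i: "i \<in> N"
  have "amount S i \<le> measure_pmf.expectation (outcome T A F (val S))
      (\<lambda>x. - indicator (F - decoys Z a) x)"
    unfolding expected_amount_def
  proof (rule expectation_mono)
    fix x assume "x \<in> F"
    then show "x ! i \<le> - indicator (F - decoys Z a) x"
      using i N_sub by (cases "x \<in> decoys Z a") (auto simp: F_def decoys_def hidden_def)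
  qed
  also have "\<dots> = - p S" by (simp add: p_def)
  finally show ?thesis .
qed

lemma amount_mono:
  assumes "i \<in> N - S"
  shows "amount S i \<le> amount (insert i S) i"
proof -
  have i: "i < Suc (4 * a)" using assms N_sub by auto
  have "val S ! i \<le> h" using l_less_h by (simp add: nth_val[OF i])
  then have "amount S i \<le> expected_amount T A F ((val S)[i := h]) i"
    using monotone val_in_valuations i unfolding monotone_rule_def by blast
  also have "(val S)[i := h] = val (insert i S)"
  proof (rule nth_equalityI)
    fix j assume "j < length ((val S)[i := h])"
    then show "(val S)[i := h] ! j = val (insert i S) ! j"
      by (cases "j = i") (auto simp: nth_val)
  qed simp
  finally show ?thesis .
qed

lemma expected_welfare_le:
  assumes "S \<subseteq> N" "card S \<le> L"
  shows "expected_welfare T A F (val S)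
    \<le> (W S + \<kappa>) * p S + \<kappa> / real (card (N - S)) * (\<Sum>i\<in>N - S. amount S i)"
proof -
  have "expected_welfare T A F (val S) \<le> measure_pmf.expectation (outcome T A F (val S))
      (\<lambda>x. (W S + \<kappa>) * indicator (F - decoys Z a) x
        + \<kappa> / real (card (N - S)) * (\<Sum>i\<in>N - S. x ! i))"
    unfolding expected_welfare_def by (rule expectation_mono) (rule welfare_le[OF assms])
  also have "\<dots> = (W S + \<kappa>) * p S + \<kappa> / real (card (N - S)) * (\<Sum>i\<in>N - S. amount S i)"
    unfolding p_def expected_amount_def
    by (subst Bochner_Integration.integral_add)
      (auto intro!: integrable_outcome simp: Bochner_Integration.integral_sum[OF integrable_outcome])
  finally show ?thesis .
qed

text \<open>The expected welfare is at least \<open>c * W S\<close>. Decoys contribute nothing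
  positive, and any other output at most \<open>W S + \<kappa>\<close>, which
  \<open>W S \<ge> l\<close> bounds by \<open>a * W S\<close>.\<close>

lemma p_ge_top:
  assumes "S \<subseteq> N" "card S = L"
  shows "c / real a \<le> p S"
proof (rule ccontr)
  assume "\<not> c / real a \<le> p S"
  have a_pos: "0 < real a" using twice_\<sigma>_le \<sigma>_ge_1 by linarith
  have W: "l \<le> W S" using margin by (simp add: W_def assms(2))
  have "A (val S) = prize Z a N" by (simp add: algorithm_def high_agents_val assms)
  then have "c * W S \<le> expected_welfare T A F (val S)"
    using preserving[OF val_in_valuations, of S] welfare_prize[OF assms(1)] by simp
  also have "\<dots> \<le> (W S + \<kappa>) * p S + \<kappa> / real (card (N - S)) * (\<Sum>i\<in>N - S. amount S i)"
    using assms by (intro expected_welfare_le) auto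
  also have "\<kappa> / real (card (N - S)) * (\<Sum>i\<in>N - S. amount S i) \<le> 0"
  proof (intro mult_nonneg_nonpos sum_nonpos)
    fix i assume "i \<in> N - S"
    then show "amount S i \<le> 0" using amount_le[of i S] p_nonneg[of S] by simp
  qed (use \<kappa>_pos in simp)
  also have "(W S + \<kappa>) * p S < (W S + \<kappa>) * (c / real a)"
    using \<open>\<not> c / real a \<le> p S\<close> W l_pos \<kappa>_pos by (intro mult_strict_left_mono) auto
  finally have "c * W S < c * (W S + \<kappa>) / real a" by (simp add: mult.commute)
  then have "c * (real a * W S) < c * (W S + \<kappa>)" using a_pos by (simp add: field_simps)
  then have "real a * W S < W S + \<kappa>" using c_pos mult_less_cancel_left_pos by blast
  moreover have "\<kappa> \<le> (real a - 1) * l"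
    using l_pos \<sigma>_ge_1 by (simp add: \<kappa>_def mult.commute)
  moreover have "(real a - 1) * l \<le> (real a - 1) * W S"
    using W \<sigma>_ge_1 twice_\<sigma>_le by (intro mult_left_mono) auto
  ultimately show False by (simp add: algebra_simps)
qed

text \<open>Nonnegative expected welfare gives
  \<open>\<kappa> * q \<le> (W S + \<kappa>) * p S\<close>. The factor arises from
  \<open>\<kappa> = l * (a - \<sigma>)\<close> and
  \<open>W S + \<kappa> \<le> l * a\<close>.\<close>

lemma p_ge_step:
  assumes S: "S \<subseteq> N" "card S < L" and q: "\<And>i. i \<in> N - S \<Longrightarrow> q \<le> p (insert i S)"
  shows "(1 - \<sigma> / real a) * q \<le> p S"
proof -
  have a_pos: "0 < real a" using twice_\<sigma>_le \<sigma>_ge_1 by linarith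
  define r where "r = real (card (N - S))"
  have r_pos: "0 < r" using S card_diff_real[OF S(1)] L_le_a unfolding r_def by linarith
  have "A (val S) = replicate (Suc (4 * a)) 0"
    using S by (simp add: algorithm_def high_agents_val)
  then have "welfare (val S) (A (val S)) = 0"
    by (simp add: welfare_def del: replicate.simps)
  then have "0 \<le> expected_welfare T A F (val S)"
    using preserving[OF val_in_valuations, of S] by simp
  also have "\<dots> \<le> (W S + \<kappa>) * p S + \<kappa> / r * (\<Sum>i\<in>N - S. amount S i)"
    unfolding r_def using S by (intro expected_welfare_le) auto
  also have "\<kappa> / r * (\<Sum>i\<in>N - S. amount S i) \<le> \<kappa> / r * (\<Sum>i\<in>N - S. - q)"
  proof (intro mult_left_mono sum_mono)
    fix i assume i: "i \<in> N - S"
    \<comment> \<open>The charge that \<open>i\<close> bears at \<open>insert i S\<close> carries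
      over to \<open>S\<close>, since a lower declared value cannot bring a larger amount.\<close>
    show "amount S i \<le> - q"
      using amount_mono[OF i] amount_le[of i "insert i S"] q[OF i] i by simp
  qed (use \<kappa>_pos r_pos in simp)
  also have "\<kappa> / r * (\<Sum>i\<in>N - S. - q) = - \<kappa> * q"
    using r_pos by (simp add: r_def)
  finally have "\<kappa> * q \<le> (W S + \<kappa>) * p S" by simp
  also have "\<dots> \<le> (l * real a) * p S"
  proof (rule mult_right_mono[OF _ p_nonneg])
    have "0 \<le> (h - l) * real (card S)" using l_less_h by simp
    then show "W S + \<kappa> \<le> l * real a" by (simp add: W_def \<kappa>_def algebra_simps)
  qed
  finally have "l * ((real a - \<sigma>) * q) \<le> l * (real a * p S)" by (simp add: \<kappa>_def mult.assoc)
  then have "(real a - \<sigma>) * q \<le> real a * p S" using l_pos mult_le_cancel_left_pos by blast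
  then show ?thesis using a_pos by (simp add: field_simps)
qed

lemma p_ge:
  assumes "S \<subseteq> N" "card S + d = L"
  shows "(1 - \<sigma> / real a) ^ d * (c / real a) \<le> p S"
  using assms
proof (induction d arbitrary: S)
  case 0
  then show ?case using p_ge_top by simp
next
  case (Suc d)
  have fin: "finite S" using Suc.prems(1) finite_N finite_subset by blast
  have "(1 - \<sigma> / real a) * ((1 - \<sigma> / real a) ^ d * (c / real a)) \<le> p S"
    using Suc.prems fin by (intro p_ge_step Suc.IH) auto
  then show ?case by (simp add: mult.assoc)
qed

text \<open>Descending from \<open>L\<close> high values to none accumulates
  \<open>(1 - \<sigma> / a) ^ L\<close>, which Bernoulli's inequality and \<open>a_large\<close>
  keep above one half.\<close>

lemma p_empty_ge: "c / (2 * real a) \<le> p {}"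
proof -
  have a_pos: "0 < real a" using twice_\<sigma>_le \<sigma>_ge_1 by linarith
  have "1 / 2 \<le> 1 + real L * (- \<sigma> / real a)"
    using a_large a_pos by (simp add: field_simps)
  also have "\<dots> \<le> (1 + - \<sigma> / real a) ^ L"
    using a_pos twice_\<sigma>_le \<sigma>_ge_1 by (intro Bernoulli_inequality) (simp add: field_simps)
  finally have "1 / 2 * (c / real a) \<le> (1 - \<sigma> / real a) ^ L * (c / real a)"
    using c_pos a_pos by (intro mult_right_mono) auto
  also have "\<dots> \<le> p {}" by (rule p_ge) auto
  finally show ?thesis by simp
qed

end

section \<open>Counting secret sets\<close>

text \<open>One agent is chosen from each pair \<open>Suc j\<close>, \<open>Suc (2 * a + j)\<close>
  with \<open>j < 2 * a\<close>. All these sets have the same size, and the choices are independent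
  bits, so probabilities become powers of 2.\<close>

definition secret :: "nat \<Rightarrow> nat set \<Rightarrow> nat set" where
  "secret a J = (\<lambda>j. if j \<in> J then Suc j else Suc (2 * a + j)) ` {..<2 * a}"

lemma secret_sub: "secret a J \<subseteq> {1..4 * a}"
  by (auto simp: secret_def)

lemma card_secret: "card (secret a J) = 2 * a"
proof -
  have "inj_on (\<lambda>j. if j \<in> J then Suc j else Suc (2 * a + j)) {..<2 * a}"
    by (rule inj_onI) (auto split: if_splits)
  then have "card (secret a J) = card {..<2 * a}"
    unfolding secret_def by (rule card_image)
  then show ?thesis by simp
qed

lemma Suc_in_secret: "j < 2 * a \<Longrightarrow> Suc j \<in> secret a J \<longleftrightarrow> j \<in> J"
  by (auto simp: secret_def image_iff split: if_splits)

lemma Suc_add_in_secret: "j < 2 * a \<Longrightarrow> Suc (2 * a + j) \<in> secret a J \<longleftrightarrow> j \<notin> J"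
  by (auto simp: secret_def image_iff split: if_splits)

lemma card_fixed_on_le:
  assumes "K \<subseteq> {..<m}" and "\<And>J j. J \<in> \<J> \<Longrightarrow> j \<in> K \<Longrightarrow> j \<in> J \<longleftrightarrow> P j"
    and "\<J> \<subseteq> Pow {..<m}"
  shows "card \<J> \<le> 2 ^ (m - card K)"
proof -
  have "inj_on (\<lambda>J. J - K) \<J>"
    by (rule inj_onI) (use assms(2) in blast)
  moreover have "(\<lambda>J. J - K) ` \<J> \<subseteq> Pow ({..<m} - K)"
    using assms(3) by auto
  ultimately have "card \<J> \<le> card (Pow ({..<m} - K))"
    by (rule card_inj_on_le) simp
  also have "\<dots> = 2 ^ (m - card K)"
    using assms(1) by (simp add: card_Pow card_Diff_subset finite_subset)
  finally show ?thesis .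
qed

text \<open>A secret set has one agent per pair, so an \<open>H\<close> inside some secret set meets
  \<open>L\<close> different pairs and fixes the choice in each.\<close>

lemma card_secrets_containing_le:
  assumes "card H = L"
  shows "card {J\<in>Pow {..<2 * a}. H \<subseteq> secret a J} \<le> 2 ^ (2 * a - L)"
proof (cases "\<exists>J. H \<subseteq> secret a J")
  case True
  then obtain J\<^sub>0 where J\<^sub>0: "H \<subseteq> secret a J\<^sub>0" by blast
  define K where "K = {j\<in>{..<2 * a}. Suc j \<in> H \<or> Suc (2 * a + j) \<in> H}"
  have "H \<subseteq> (\<lambda>j. if j \<in> J\<^sub>0 then Suc j else Suc (2 * a + j)) ` K"
    using J\<^sub>0 by (auto simp: K_def secret_def image_iff subset_iff split: if_splits)
  moreover have "finite K" by (simp add: K_def)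
  ultimately have "L \<le> card K"
    using assms surj_card_le by blast
  have "card {J\<in>Pow {..<2 * a}. H \<subseteq> secret a J} \<le> 2 ^ (2 * a - card K)"
  proof (rule card_fixed_on_le)
    fix J j
    assume "J \<in> {J\<in>Pow {..<2 * a}. H \<subseteq> secret a J}" and "j \<in> K"
    then show "j \<in> J \<longleftrightarrow> Suc j \<in> H"
      using Suc_in_secret[of j a J] Suc_add_in_secret[of j a J] by (auto simp: K_def)
  qed (auto simp: K_def)
  also have "(2::nat) ^ (2 * a - card K) \<le> 2 ^ (2 * a - L)"
    using \<open>L \<le> card K\<close> by (intro power_increasing) auto
  finally show ?thesis .
qed auto

text \<open>An \<open>M\<close> that contains a secret set meets all \<open>2 * a\<close> pairs.
  Having fewer than \<open>3 * a\<close> elements, it contains fewer than \<open>a\<close> pairs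
  entirely; in each of the others, more than \<open>a\<close> in number, the choice is
  forced.\<close>

lemma card_secrets_contained_le:
  assumes "M \<subseteq> {1..4 * a}" "card M < 3 * a" "L \<le> a"
  shows "card {J\<in>Pow {..<2 * a}. secret a J \<subseteq> M} \<le> 2 ^ (2 * a - L)"
proof (cases "\<exists>J. secret a J \<subseteq> M")
  case True
  then obtain J\<^sub>0 where J\<^sub>0: "secret a J\<^sub>0 \<subseteq> M" by blast
  define B where "B = {j\<in>{..<2 * a}. Suc j \<in> M}"
  define C where "C = {j\<in>{..<2 * a}. Suc (2 * a + j) \<in> M}"
  define K where "K = {..<2 * a} - B \<inter> C"
  have fin: "finite M" using assms(1) finite_subset by blast
  have "j \<in> B \<union> C" if "j < 2 * a" for j
    using J\<^sub>0 that Suc_in_secret[OF that, of J\<^sub>0] Suc_add_in_secret[OF that, of J\<^sub>0]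
    by (auto simp: B_def C_def)
  then have "B \<union> C = {..<2 * a}" by (auto simp: B_def C_def)
  then have "2 * a + card (B \<inter> C) = card B + card C"
    using card_Un_Int[of B C] by (simp add: B_def C_def)
  also have "\<dots> = card (Suc ` B) + card ((\<lambda>j. Suc (2 * a + j)) ` C)"
    by (simp add: card_image inj_on_def)
  also have "\<dots> = card (Suc ` B \<union> (\<lambda>j. Suc (2 * a + j)) ` C)"
    by (rule card_Un_disjoint[symmetric]) (auto simp: B_def C_def)
  also have "\<dots> \<le> card M"
    using fin by (intro card_mono) (auto simp: B_def C_def)
  finally have "card (B \<inter> C) < a" using assms(2) by simp
  moreover have "card K = 2 * a - card (B \<inter> C)"
    unfolding K_def by (subst card_Diff_subset) (auto simp: B_def)
  ultimately have "L \<le> card K" using assms(3) by simp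
  have "card {J\<in>Pow {..<2 * a}. secret a J \<subseteq> M} \<le> 2 ^ (2 * a - card K)"
  proof (rule card_fixed_on_le)
    fix J j
    assume "J \<in> {J\<in>Pow {..<2 * a}. secret a J \<subseteq> M}" and "j \<in> K"
    then show "j \<in> J \<longleftrightarrow> Suc j \<in> M"
      using Suc_in_secret[of j a J] Suc_add_in_secret[of j a J] by (auto simp: K_def B_def C_def)
  qed (auto simp: K_def)
  also have "(2::nat) ^ (2 * a - card K) \<le> 2 ^ (2 * a - L)"
    using \<open>L \<le> card K\<close> by (intro power_increasing) auto
  finally show ?thesis .
qed auto

text \<open>A query is answered differently from the zero algorithm only if its \<open>L\<close>
  high agents all happen to be in the secret set.\<close>

lemma card_algorithm_differs_le:
  "card {J\<in>Pow {..<2 * a}. algorithm h Z a L (secret a J) v \<noteq> replicate (Suc (4 * a)) 0}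
    \<le> 2 ^ (2 * a - L)"
proof (cases "card (high_agents h v) = L")
  case True
  have "card {J\<in>Pow {..<2 * a}. algorithm h Z a L (secret a J) v \<noteq> replicate (Suc (4 * a)) 0}
      \<le> card {J\<in>Pow {..<2 * a}. high_agents h v \<subseteq> secret a J}"
    by (rule card_mono) (auto simp: algorithm_def)
  also have "\<dots> \<le> 2 ^ (2 * a - L)" by (rule card_secrets_containing_le[OF True])
  finally show ?thesis .
qed (simp add: algorithm_def)

lemma card_feasible_differs_le:
  assumes "L \<le> a"
  shows "card {J\<in>Pow {..<2 * a}. (x \<in> decoys Z a \<union> hidden Z a (secret a J)) \<noteq> (x \<in> decoys Z a)}
    \<le> 2 ^ (2 * a - L)"
proof (cases "x \<in> decoys Z a \<or> \<not> (\<exists>J. x \<in> hidden Z a (secret a J))")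
  case True
  then have "{J\<in>Pow {..<2 * a}. (x \<in> decoys Z a \<union> hidden Z a (secret a J)) \<noteq> (x \<in> decoys Z a)} = {}"
    by auto
  then show ?thesis by (simp only: card.empty le0)
next
  case False
  define M where "M = {i\<in>{1..4 * a}. x ! i \<le> -1}"
  \<comment> \<open>Here \<open>x\<close> meets all conditions of \<open>decoys Z a\<close> except
    the one on the number of charged agents, and \<open>x ! 0\<close> is positive.\<close>
  have "card M < 3 * a"
    using False by (auto simp: decoys_def hidden_def M_def not_le)
  have "card {J\<in>Pow {..<2 * a}. (x \<in> decoys Z a \<union> hidden Z a (secret a J)) \<noteq> (x \<in> decoys Z a)}
      \<le> card {J\<in>Pow {..<2 * a}. secret a J \<subseteq> M}"
    using secret_sub by (intro card_mono) (fastforce simp: hidden_def M_def)+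
  also have "\<dots> \<le> 2 ^ (2 * a - L)"
    by (rule card_secrets_contained_le[OF _ \<open>card M < 3 * a\<close> assms]) (auto simp: M_def)
  finally show ?thesis .
qed

section \<open>Choice of the size parameter\<close>

text \<open>With \<open>a = 2 * R * L\<^sup>2\<close> there are
  \<open>4 * a + 1 = 8 * R * L\<^sup>2 + 1\<close> agents, and the left side is \<open>2 * a\<close>
  times the time bound, a polynomial in \<open>L\<close>.\<close>

lemma exponential_exceeds_poly:
  fixes q :: "nat poly" and R :: nat and c :: real
  assumes "0 < c" "0 < R"
  shows "\<exists>L>0. real (4 * R * L\<^sup>2 * poly q (8 * R * L\<^sup>2 + 1)) < c * 2 ^ L"
proof -
  define d where "d = degree q"
  \<comment> \<open>The summand 1 keeps \<open>B\<close> positive even for the zero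
    polynomial.\<close>
  define B where "B = 1 + (\<Sum>i\<le>d. coeff q i)"
  define C where "C = 9 * real R"
  have C_pos: "C > 0" using assms(2) by (simp add: C_def)
  have B_pos: "B > 0" by (simp add: B_def)
  have poly_le: "poly q n \<le> B * n ^ d" if "n \<ge> 1" for n
  proof -
    have "poly q n = (\<Sum>i\<le>d. coeff q i * n ^ i)" by (simp add: poly_altdef d_def)
    also have "\<dots> \<le> (\<Sum>i\<le>d. coeff q i * n ^ d)"
      using that by (intro sum_mono mult_left_mono power_increasing) auto
    also have "\<dots> \<le> B * n ^ d" by (simp add: B_def sum_distrib_right[symmetric])
    finally show ?thesis .
  qed
  have "(\<lambda>L::nat. C * real L ^ 2 * (C * real L ^ 2) ^ d / 2 ^ L) \<longlonglongrightarrow> 0"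
    using C_pos by real_asymp
  then have "eventually (\<lambda>L::nat. C * real L ^ 2 * (C * real L ^ 2) ^ d / 2 ^ L < c / real B) sequentially"
    by (rule order_tendstoD) (use assms(1) B_pos in simp)
  then have "eventually (\<lambda>L::nat. C * real L ^ 2 * (C * real L ^ 2) ^ d / 2 ^ L < c / real B \<and> L > 0) sequentially"
    using eventually_gt_at_top[of "0::nat"] by (rule eventually_conj)
  then obtain L :: nat where L: "C * real L ^ 2 * (C * real L ^ 2) ^ d / 2 ^ L < c / real B" "L > 0"
    using eventually_happens by fastforce
  have "1 \<le> R * L\<^sup>2" using L(2) assms(2) by simp
  then have n: "8 * R * L\<^sup>2 + 1 \<le> 9 * R * L\<^sup>2" by simp
  have "4 * R * L\<^sup>2 * poly q (8 * R * L\<^sup>2 + 1) \<le> 9 * R * L\<^sup>2 * (B * (9 * R * L\<^sup>2) ^ d)"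
    by (intro mult_mono order_trans[OF poly_le] power_mono n) auto
  then have "real (4 * R * L\<^sup>2 * poly q (8 * R * L\<^sup>2 + 1))
      \<le> real (9 * R * L\<^sup>2 * (B * (9 * R * L\<^sup>2) ^ d))"
    by (rule of_nat_mono)
  also have "\<dots> = real B * (C * real L ^ 2 * (C * real L ^ 2) ^ d)"
    by (simp add: C_def algebra_simps)
  also have "\<dots> < c * 2 ^ L"
    using L(1) B_pos by (simp add: field_simps)
  finally show ?thesis using L(2) by blast
qed

section \<open>Averaging over all secret sets\<close>

theorem theorem2:
  fixes l h :: real
  assumes "0 < l" and "l < h"
  shows "\<not> (\<exists>T :: 's transformation.
            outputs_feasible l h T \<and>
            polynomial_time l h T \<and>
            monotone_transformation l h T \<and>
            constant_fraction_welfare_preserving l h T)"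
proof
  assume "\<exists>T :: 's transformation. outputs_feasible l h T \<and> polynomial_time l h T \<and>
    monotone_transformation l h T \<and> constant_fraction_welfare_preserving l h T"
  then obtain T :: "'s transformation" and q :: "nat poly" and c :: real
    where feas: "outputs_feasible l h T"
      and time: "\<And>n F A v. is_instance l h n F A \<Longrightarrow> v \<in> valuations l h n \<Longrightarrow>
        halts_within T A F v (poly q n)"
      and mono: "monotone_transformation l h T"
      and c: "0 < c"
      and welf: "\<And>n F A v. is_instance l h n F A \<Longrightarrow> v \<in> valuations l h n \<Longrightarrow>
        c * welfare v (A v) \<le> expected_welfare T A F v"
    unfolding polynomial_time_def constant_fraction_welfare_preserving_def by blast
  obtain R :: nat where R: "h / l \<le> real R" using real_arch_simple by blast
  have h_le: "h \<le> l * real R" using R assms(1) by (simp add: field_simps)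
  have R_pos: "0 < R" using h_le assms by (cases "R = 0") auto
  obtain L where L: "L > 0" "real (4 * R * L\<^sup>2 * poly q (8 * R * L\<^sup>2 + 1)) < c * 2 ^ L"
    using exponential_exceeds_poly[OF c R_pos] by blast
  \<comment> \<open>As \<open>R \<ge> h / l\<close>, this gives
    \<open>l * \<sigma> \<ge> h * L\<close> and hence \<open>margin\<close>; the next line takes the
    least \<open>a\<close> that \<open>a_large\<close> admits.\<close>
  define \<sigma> where "\<sigma> = real (R * L)"
  define a where "a = 2 * L * (R * L)"
  define Z where "Z = 2 * real a + \<sigma>"
  define F where "F = (\<lambda>J. decoys Z a \<union> hidden Z a (secret a J))"
  define A where "A = (\<lambda>J. algorithm h Z a L (secret a J))"
  \<comment> \<open>This is \<open>val {}\<close> for every \<open>J\<close>, so all runs start in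
    the same state, as the union bound requires.\<close>
  define v where "v = map (\<lambda>i. l) [0..<Suc (4 * a)]"
  define t where "t = poly q (Suc (4 * a))"
  have inst: "hidden_instance l h \<sigma> a L (secret a J)" for J
  proof
    have "l \<le> l * real L" using assms(1) L(1) by simp
    then have "l + (h - l) * real L \<le> h * real L" by (simp add: algebra_simps)
    also have "\<dots> \<le> l * real R * real L" using h_le by (intro mult_right_mono) auto
    finally show "l + (h - l) * real L \<le> l * \<sigma>" by (simp add: \<sigma>_def mult.assoc)
    show "2 * real L * \<sigma> \<le> real a" by (simp add: \<sigma>_def a_def)
  qed (use assms L(1) in \<open>simp_all add: secret_sub card_secret del: One_nat_def\<close>)
  have a_pos: "0 < a" using R_pos L(1) by (simp add: a_def)
  have L_le_a: "L \<le> a" using hidden_instance.L_le_a[OF inst] .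
  have finds: "c / (2 * real a)
      \<le> measure_pmf.prob (run T (A J) (F J) t (initial T v)) (Some ` (F J - decoys Z a))" for J
  proof -
    interpret I: hidden_instance l h \<sigma> a L "secret a J" by (rule inst)
    have eqs: "I.Z = Z" "I.F = F J" "I.val {} = v"
      unfolding I.Z_def I.F_def I.val_def Z_def F_def v_def by simp_all
    have A: "A J = algorithm h I.Z a L (secret a J)" by (simp add: A_def eqs)
    interpret I: hidden_instance_transformation l h \<sigma> a L "secret a J" T c
    proof
      show "set_pmf (outcome T (algorithm h I.Z a L (secret a J)) I.F v) \<subseteq> I.F"
        if "v \<in> valuations l h (Suc (4 * a))" for v
        using feas I.is_instance that unfolding outputs_feasible_def by blast
      show "monotone_rule l h (Suc (4 * a))
          (expected_amount T (algorithm h I.Z a L (secret a J)) I.F)"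
        using mono I.is_instance unfolding monotone_transformation_def by blast
    qed (use c welf I.is_instance in auto)
    have "c / (2 * real a) \<le> measure_pmf.prob (outcome T (A J) (F J) v) (F J - decoys Z a)"
      using I.p_empty_ge by (simp add: I.p_def eqs A)
    also have "\<dots> \<le> measure_pmf.prob (run T (A J) (F J) t (initial T v)) (Some ` (F J - decoys Z a))"
    proof (rule prob_outcome_le_run)
      show "halts_within T (A J) (F J) v t"
        using time[OF I.is_instance I.val_in_valuations, of "{}"] by (simp add: t_def eqs A)
    qed
    finally show ?thesis .
  qed
  \<comment> \<open>The lower bound \<open>finds\<close>, summed over all \<open>J\<close>, meets
    the union bound, whose reference instance has the zero algorithm and only decoys as feasible
    allocations.\<close>
  have "2 ^ (2 * a) * (c / (2 * real a)) = (\<Sum>J\<in>Pow {..<2 * a}. c / (2 * real a))"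
    by (simp add: card_Pow)
  also have "\<dots> \<le> (\<Sum>J\<in>Pow {..<2 * a}.
      measure_pmf.prob (run T (A J) (F J) t (initial T v)) (Some ` (F J - decoys Z a)))"
    by (intro sum_mono finds)
  also have "\<dots> \<le> real t * 2 ^ (2 * a - L)"
  proof (rule sum_prob_run_le[where A\<^sub>0 = "\<lambda>_. replicate (Suc (4 * a)) 0", OF _ subset_refl])
    fix u
    show "real (card {J\<in>Pow {..<2 * a}. A J u \<noteq> replicate (Suc (4 * a)) 0}) \<le> 2 ^ (2 * a - L)"
      unfolding A_def by (rule order_trans[OF of_nat_mono[OF card_algorithm_differs_le]]) simp
  next
    fix x
    show "real (card {J\<in>Pow {..<2 * a}. (x \<in> F J) \<noteq> (x \<in> decoys Z a)}) \<le> 2 ^ (2 * a - L)"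
      unfolding F_def by (rule order_trans[OF of_nat_mono[OF card_feasible_differs_le[OF L_le_a]]]) simp
  qed auto
  finally have "2 ^ (2 * a - L) * (2 ^ L * (c / (2 * real a))) \<le> 2 ^ (2 * a - L) * real t"
    using L_le_a by (simp add: mult_ac flip: power_add)
  then have "2 ^ L * (c / (2 * real a)) \<le> real t"
    by (rule mult_left_le_imp_le) simp
  then have "c * 2 ^ L \<le> 2 * real a * real t"
    using a_pos by (simp add: field_simps)
  also have "\<dots> = real (4 * R * L\<^sup>2 * poly q (8 * R * L\<^sup>2 + 1))"
    by (simp add: a_def t_def power2_eq_square algebra_simps)
  finally show False using L(2) by simp
qed

end
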